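(* Let $G=(V,E)$ be the graph ($1$-skeleton) of a simple $3$-dimensional polytope. Fix $v\in V$ and let $\mathcal{C}(v)$ denote the set of $2$-faces incident to $v$. For each $C\in\mathcal{C}(v)$ let $\ell_C$ be the number of edges of $C$. Then $$\kappa(v)\ \geq\ 1-\frac12\sum_{C\in\mathcal{C}(v)}\frac{\ell_C-1}{(\ell_C-1)\left(\sum_{C'\in\mathcal{C}(v)}\frac{1}{\ell_{C'}-1}+1\right)-1}.$$
   Context: A $3$-polytope is simple if its graph is $3$-regular. For a finite graph $G=(V,E)$ with Laplacian $\mathbf{L}=\mathbf{D}-\mathbf{A}$ (degree matrix minus adjacency matrix) and Moore--Penrose pseudoinverse $\mathbf{L}^\dagger$, the effective resistance between $u,v$ is $r_{uv}=(\mathbf{1}_u-\mathbf{1}_v)^\top\mathbf{L}^\dagger(\mathbf{1}_u-\mathbf{1}_v)$, and the resistance curvature at $v$ is $\kappa(v)=1-\frac12\sum_{u\sim v} r_{uv}$, summing over neighbors $u$ of $v$. *)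

theory Defs
  imports "HOL-Analysis.Analysis"
begin

text \<open>
  A graph is given by its vertex set \<open>V\<close> and its set \<open>E\<close> of edges, each edge being an
  unordered pair \<open>{u, v}\<close> of distinct vertices.  Since \<open>V\<close> is a set and not a type,
  \<open>V \<times> V\<close> matrices are functions of two vertices, of which only the entries with both
  indices in \<open>V\<close> are relevant.
\<close>

definition nbrs :: "'v set \<Rightarrow> 'v set set \<Rightarrow> 'v \<Rightarrow> 'v set" where
  "nbrs V E v = {u \<in> V. {u, v} \<in> E}"

definition regular_graph :: "nat \<Rightarrow> 'v set \<Rightarrow> 'v set set \<Rightarrow> bool" where
  "regular_graph k V E \<longleftrightarrow> (\<forall>v\<in>V. card (nbrs V E v) = k)"

definition degree_matrix :: "'v set \<Rightarrow> 'v set set \<Rightarrow> 'v \<Rightarrow> 'v \<Rightarrow> real" where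
  "degree_matrix V E i j = (if i \<in> V \<and> i = j then real (card (nbrs V E i)) else 0)"

definition adjacency_matrix :: "'v set \<Rightarrow> 'v set set \<Rightarrow> 'v \<Rightarrow> 'v \<Rightarrow> real" where
  "adjacency_matrix V E i j = (if i \<in> V \<and> j \<in> V \<and> {i, j} \<in> E then 1 else 0)"

definition laplacian :: "'v set \<Rightarrow> 'v set set \<Rightarrow> 'v \<Rightarrow> 'v \<Rightarrow> real" where
  "laplacian V E i j = degree_matrix V E i j - adjacency_matrix V E i j"

definition mat_mult ::
    "'v set \<Rightarrow> ('v \<Rightarrow> 'v \<Rightarrow> real) \<Rightarrow> ('v \<Rightarrow> 'v \<Rightarrow> real) \<Rightarrow> 'v \<Rightarrow> 'v \<Rightarrow> real" where
  "mat_mult V A B i j = (\<Sum>k\<in>V. A i k * B k j)"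

text \<open>
  The four Penrose equations.  Requiring \<open>B\<close> to vanish outside \<open>V \<times> V\<close> makes \<open>B\<close> unique
  as a function, so that for finite \<open>V\<close> the description in \<open>pseudoinverse\<close> is proper.
\<close>

definition is_pseudoinverse ::
    "'v set \<Rightarrow> ('v \<Rightarrow> 'v \<Rightarrow> real) \<Rightarrow> ('v \<Rightarrow> 'v \<Rightarrow> real) \<Rightarrow> bool" where
  "is_pseudoinverse V A B \<longleftrightarrow>
     (\<forall>i\<in>V. \<forall>j\<in>V. mat_mult V (mat_mult V A B) A i j = A i j) \<and>
     (\<forall>i\<in>V. \<forall>j\<in>V. mat_mult V (mat_mult V B A) B i j = B i j) \<and>
     (\<forall>i\<in>V. \<forall>j\<in>V. mat_mult V A B i j = mat_mult V A B j i) \<and>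
     (\<forall>i\<in>V. \<forall>j\<in>V. mat_mult V B A i j = mat_mult V B A j i) \<and>
     (\<forall>i j. i \<notin> V \<or> j \<notin> V \<longrightarrow> B i j = 0)"

definition pseudoinverse :: "'v set \<Rightarrow> ('v \<Rightarrow> 'v \<Rightarrow> real) \<Rightarrow> 'v \<Rightarrow> 'v \<Rightarrow> real" where
  "pseudoinverse V A = (THE B. is_pseudoinverse V A B)"

definition effective_resistance :: "'v set \<Rightarrow> 'v set set \<Rightarrow> 'v \<Rightarrow> 'v \<Rightarrow> real" where
  "effective_resistance V E u v =
     (\<Sum>i\<in>V. \<Sum>j\<in>V. (indicator {u} i - indicator {v} i) *
        pseudoinverse V (laplacian V E) i j * (indicator {u} j - indicator {v} j))"

definition resistance_curvature :: "'v set \<Rightarrow> 'v set set \<Rightarrow> 'v \<Rightarrow> real" where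
  "resistance_curvature V E v = 1 - 1/2 * (\<Sum>u\<in>nbrs V E v. effective_resistance V E u v)"

definition polytope_verts :: "'a::euclidean_space set \<Rightarrow> 'a set" where
  "polytope_verts P = {v. v extreme_point_of P}"

definition polytope_edges :: "'a::euclidean_space set \<Rightarrow> 'a set set" where
  "polytope_edges P = {{u, v} | u v. closed_segment u v edge_of P}"

definition simple_3_polytope :: "'a::euclidean_space set \<Rightarrow> bool" where
  "simple_3_polytope P \<longleftrightarrow>
     polytope P \<and> aff_dim P = 3 \<and> regular_graph 3 (polytope_verts P) (polytope_edges P)"

definition incident_2_faces :: "'a::euclidean_space set \<Rightarrow> 'a \<Rightarrow> 'a set set" where
  "incident_2_faces P v = {C. C face_of P \<and> aff_dim C = 2 \<and> v \<in> C}"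

definition num_edges :: "'a::euclidean_space set \<Rightarrow> nat" where
  "num_edges C = card {e. e edge_of C}"

end

theory Submission
  imports Defs
begin

text \<open>
  Let \<open>\<phi> = L\<^sup>\<dagger> (1\<^sub>u - 1\<^sub>v)\<close>.  Then \<open>r = \<phi> u - \<phi> v\<close> is also the Dirichlet energy of \<open>\<phi>\<close>.
  The edge \<open>uv\<close> contributes \<open>r\<^sup>2\<close> to the energy, and by Cauchy-Schwarz a face with \<open>l\<close> edges through \<open>uv\<close>
  contributes at least \<open>r\<^sup>2 / (l - 1)\<close> on its remaining edges.  The two faces through an edge \<open>uv\<close>
  share no further edge, so \<open>r \<le> 1 / (1 + \<Sum> 1 / (l - 1))\<close>, the sum ranging over these two faces.
  At a vertex of degree 3 every neighbour is missed by exactly one of the three incident faces; indexing the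
  edges at \<open>v\<close> by that opposite face gives the summands of the theorem.
\<close>

section \<open>Edge sets with two edges at every vertex\<close>

text \<open>\<open>Max\<close> and \<open>Min\<close> make the potential drop along an edge a
  function of the unordered pair, so that no orientation has to be chosen.\<close>

definition osc :: "('v \<Rightarrow> real) \<Rightarrow> 'v set \<Rightarrow> real" where
  "osc \<phi> e = Max (\<phi> ` e) - Min (\<phi> ` e)"

lemma osc_doubleton: "osc \<phi> {a, b} = \<bar>\<phi> a - \<phi> b\<bar>"
  by (simp add: osc_def)

text \<open>These are the edge sets of disjoint unions of cycles, a purely local condition that the
  boundary of a polygon satisfies.\<close>

definition two_regular :: "'v set set \<Rightarrow> bool" where
  "two_regular F \<longleftrightarrow> finite F \<and> (\<forall>e\<in>F. card e = 2) \<and> (\<forall>x\<in>\<Union>F. card {e \<in> F. x \<in> e} = 2)"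

text \<open>
  Counting incidences shows that the number of edges leaving \<open>{x. \<phi> x \<le> t}\<close> is even.
\<close>

lemma two_regular_crosses_twice:
  assumes F: "two_regular F" and uv: "{u, v} \<in> F" "\<phi> u \<le> t" "t < (\<phi> v :: real)"
  obtains a b where "{a, b} \<in> F" "{a, b} \<noteq> {u, v}" "\<phi> a \<le> t" "t < \<phi> b"
proof (rule ccontr)
  assume "\<not> thesis"
  with that have no: "\<not> (\<phi> a \<le> t \<and> t < \<phi> b)" if "{a, b} \<in> F" "{a, b} \<noteq> {u, v}" for a b
    using that by blast
  define S where "S = {x \<in> \<Union>F. \<phi> x \<le> t}"
  have "finite e" if "e \<in> F" for e
    using F that by (intro card_ge_0_finite) (auto simp: two_regular_def)
  then have "finite (\<Union>F)"
    using F by (auto simp: two_regular_def)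
  then have fin: "finite F" "finite S"
    using F finite_subset[of S "\<Union>F"] by (auto simp: two_regular_def S_def)
  \<comment> \<open>Double counting of incidences between \<open>F\<close> and the lower set
    \<open>S\<close>; every vertex in \<open>S\<close> lies on two edges, so the total is
    even.\<close>
  have "(\<Sum>e\<in>F. card {x \<in> S. x \<in> e}) = (\<Sum>x\<in>S. card {e \<in> F. x \<in> e})"
    using sum.swap_restrict[OF fin(2,1), of "\<lambda>_ _. 1::nat" "\<lambda>x e. x \<in> e"] by simp
  also have "\<dots> = (\<Sum>x\<in>S. 2)"
    using F by (intro sum.cong) (auto simp: two_regular_def S_def)
  finally have even: "even (\<Sum>e\<in>F. card {x \<in> S. x \<in> e})" by simp
  \<comment> \<open>An edge that does not cross level \<open>t\<close> has both ends in
    \<open>S\<close> or none. Only \<open>{u, v}\<close> is left to contribute an odd number, namely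
    1.\<close>
  have "even (card {x \<in> S. x \<in> e})" if e: "e \<in> F - {{u, v}}" for e
  proof -
    have "card e = 2" using e F by (auto simp: two_regular_def)
    then obtain a b where ab: "e = {a, b}" "a \<noteq> b"
      by (auto simp: card_2_iff)
    have "{a, b} \<in> F" "{a, b} \<noteq> {u, v}" using e ab(1) by auto
    then have "\<phi> a \<le> t \<longleftrightarrow> \<phi> b \<le> t"
      using no[of a b] no[of b a] unfolding insert_commute[of b a "{}"] by linarith
    moreover have "{x \<in> S. x \<in> e} = {x \<in> {a, b}. \<phi> x \<le> t}"
      using \<open>{a, b} \<in> F\<close> unfolding S_def ab(1) by blast
    ultimately have "{x \<in> S. x \<in> e} = (if \<phi> a \<le> t then {a, b} else {})"
      by auto
    then have "card {x \<in> S. x \<in> e} = (if \<phi> a \<le> t then card {a, b} else 0)"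
      by (cases "\<phi> a \<le> t") (simp_all only: if_True if_False card.empty)
    with ab(2) show ?thesis by auto
  qed
  then have "even (\<Sum>e\<in>F - {{u, v}}. card {x \<in> S. x \<in> e})"
    by (rule dvd_sum)
  moreover have "u \<in> \<Union>F" using uv(1) by blast
  then have "u \<in> S" "v \<notin> S"
    using uv(2,3) by (simp_all add: S_def)
  then have "{x \<in> S. x \<in> {u, v}} = {u}"
    by blast
  then have "card {x \<in> S. x \<in> {u, v}} = 1" by simp
  ultimately show False
    using even sum.remove[OF fin(1) uv(1), of "\<lambda>e. card {x \<in> S. x \<in> e}"] by simp
qed

text \<open>
  Since every level \<open>t\<close> between \<open>\<phi> u\<close> and \<open>\<phi> v\<close> is crossed by another edge, the intervals spanned by the
  other edges cover \<open>{\<phi> u..<\<phi> v}\<close>; compare lengths.  No path in \<open>F\<close> has to be constructed.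
\<close>

lemma two_regular_osc_sum:
  assumes F: "two_regular F" and uv: "{u, v} \<in> F"
  shows "\<bar>\<phi> u - \<phi> v\<bar> \<le> (\<Sum>e\<in>F - {{u, v}}. osc \<phi> e)"
proof -
  have *: "\<phi> v - \<phi> u \<le> (\<Sum>e\<in>F - {{u, v}}. osc \<phi> e)" if uv: "{u, v} \<in> F" "\<phi> u \<le> \<phi> v" for u v
  proof -
    \<comment> \<open>Half-open intervals match the crossing condition
      \<open>\<phi> a \<le> t \<and> t < \<phi> b\<close> exactly, and their lengths are the values
      of \<open>osc\<close>.\<close>
    let ?I = "\<lambda>e. {Min (\<phi> ` e)..<Max (\<phi> ` e)}"
    have fin: "finite (F - {{u, v}})" using F by (auto simp: two_regular_def)
    have sub: "{\<phi> u..<\<phi> v} \<subseteq> (\<Union>e\<in>F - {{u, v}}. ?I e)"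
    proof
      fix t assume "t \<in> {\<phi> u..<\<phi> v}"
      then have t: "\<phi> u \<le> t" "t < \<phi> v" by auto
      obtain a b where "{a, b} \<in> F" "{a, b} \<noteq> {u, v}" "\<phi> a \<le> t" "t < \<phi> b"
        by (rule two_regular_crosses_twice[of F u v \<phi> t, OF F uv(1) t])
      then show "t \<in> (\<Union>e\<in>F - {{u, v}}. ?I e)"
        by (intro UN_I[of "{a, b}"]) auto
    qed
    have fm: "{a..<b} \<in> fmeasurable lborel" for a b :: real
      by (cases "a \<le> b") (auto simp: fmeasurable_def)
    have "\<phi> v - \<phi> u = measure lborel {\<phi> u..<\<phi> v}"
      using uv by simp
    also have "\<dots> \<le> measure lborel (\<Union>e\<in>F - {{u, v}}. ?I e)"
      using fin by (intro measure_mono_fmeasurable sub fmeasurable.finite_UN fm) auto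
    also have "\<dots> \<le> (\<Sum>e\<in>F - {{u, v}}. measure lborel (?I e))"
      using fin by (intro measure_UNION_le) auto
    also have "\<dots> = (\<Sum>e\<in>F - {{u, v}}. osc \<phi> e)"
    proof (intro sum.cong refl)
      fix e assume "e \<in> F - {{u, v}}"
      then have "card e = 2" using F by (auto simp: two_regular_def)
      then obtain a b where "e = {a, b}" by (auto simp: card_2_iff)
      then show "measure lborel (?I e) = osc \<phi> e" by (simp add: osc_def)
    qed
    finally show ?thesis .
  qed
  show ?thesis
  proof (cases "\<phi> u \<le> \<phi> v")
    case True
    with *[OF uv] show ?thesis by simp
  next
    case False
    with *[of v u] uv show ?thesis by (simp add: insert_commute)
  qed
qed

text \<open>Cauchy-Schwarz against the constant 1 on the \<open>card F - 1\<close> edges other than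
  \<open>{u, v}\<close>; this is the series law for unit resistors.\<close>

lemma two_regular_osc_sum_squares:
  assumes F: "two_regular F" and uv: "{u, v} \<in> F"
  shows "(\<phi> u - \<phi> v)\<^sup>2 \<le> real (card F - 1) * (\<Sum>e\<in>F - {{u, v}}. (osc \<phi> e)\<^sup>2)"
proof -
  have "(\<phi> u - \<phi> v)\<^sup>2 \<le> (\<Sum>e\<in>F - {{u, v}}. 1 * osc \<phi> e)\<^sup>2"
    using two_regular_osc_sum[OF assms, of \<phi>] by (simp add: abs_le_square_iff[symmetric])
  also have "\<dots> \<le> (\<Sum>e\<in>F - {{u, v}}. 1\<^sup>2) * (\<Sum>e\<in>F - {{u, v}}. (osc \<phi> e)\<^sup>2)"
    by (rule Cauchy_Schwarz_ineq_sum)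
  finally show ?thesis
    using assms by (simp add: two_regular_def)
qed

section \<open>The pseudoinverse of a symmetric matrix\<close>

text \<open>Induction on the columns: a generalized inverse for the columns in \<open>S\<close> is
  bordered by one new row for the column \<open>s\<close>.\<close>

lemma generalized_inverse_exists:
  fixes M :: "'r \<Rightarrow> 'c \<Rightarrow> real"
  assumes "finite S" "finite R"
  shows "\<exists>G. \<forall>i\<in>R. \<forall>j\<in>S. (\<Sum>k\<in>S. \<Sum>l\<in>R. M i k * G k l * M l j) = M i j"
  using assms(1)
proof induction
  case empty
  then show ?case by simp
next
  case (insert s S)
  then obtain G where G: "\<And>i j. i \<in> R \<Longrightarrow> j \<in> S \<Longrightarrow> (\<Sum>k\<in>S. \<Sum>l\<in>R. M i k * G k l * M l j) = M i j"
    by blast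
  \<comment> \<open>\<open>g\<close> holds the coefficients that \<open>G\<close> proposes for
    writing column \<open>s\<close> in terms of the old columns, and \<open>c\<close> is the
    residual of this attempt.\<close>
  define g where "g k = (\<Sum>l\<in>R. G k l * M l s)" for k
  define c where "c i = M i s - (\<Sum>k\<in>S. M i k * g k)" for i
  have Mg: "(\<Sum>k\<in>S. \<Sum>l\<in>R. M i k * G k l * M l s) = (\<Sum>k\<in>S. M i k * g k)" for i
    by (simp add: g_def sum_distrib_left mult.assoc)
  have ne: "k \<noteq> s" if "k \<in> S" for k
    using that insert.hyps by auto
  show ?case
  proof (cases "\<forall>i\<in>R. c i = 0")
    case True
    \<comment> \<open>Column \<open>s\<close> equals the combination of old columns given by
      \<open>g\<close>, so a zero row suffices.\<close>
    define H where "H k l = (if k = s then 0 else G k l)" for k l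
    have "(\<Sum>k\<in>insert s S. \<Sum>l\<in>R. M i k * H k l * M l j) = M i j"
      if "i \<in> R" "j \<in> insert s S" for i j
    proof -
      have "(\<Sum>k\<in>insert s S. \<Sum>l\<in>R. M i k * H k l * M l j) = (\<Sum>k\<in>S. \<Sum>l\<in>R. M i k * G k l * M l j)"
        using insert.hyps ne by (simp add: H_def)
      then show ?thesis
        using that True G Mg by (auto simp: c_def)
    qed
    then show ?thesis by blast
  next
    case False
    then obtain r where r: "r \<in> R" "c r \<noteq> 0" by blast
    \<comment> \<open>Row \<open>r\<close> of \<open>I - M G\<close>, scaled by \<open>c r\<close>:
      as a functional on columns it kills the old ones and takes the value 1 on column
      \<open>s\<close>. With the correction \<open>g k * h l\<close> below,
      \<open>M H M = M G M + c (h M)\<close>, which adds the residual to column \<open>s\<close>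
      only.\<close>
    define h where "h l = ((if l = r then 1 else 0) - (\<Sum>k\<in>S. M r k * G k l)) / c r" for l
    define H where "H k l = (if k = s then h l else G k l - g k * h l)" for k l
    have hM: "(\<Sum>l\<in>R. h l * M l j) = (M r j - (\<Sum>k\<in>S. \<Sum>l\<in>R. M r k * G k l * M l j)) / c r" for j
    proof -
      have "(\<Sum>l\<in>R. h l * M l j) = (\<Sum>l\<in>R. (if l = r then M l j else 0) - (\<Sum>k\<in>S. M r k * G k l * M l j)) / c r"
        unfolding sum_divide_distrib
        by (intro sum.cong refl) (auto simp: h_def left_diff_distrib diff_divide_distrib sum_distrib_right)
      also have "\<dots> = (M r j - (\<Sum>l\<in>R. \<Sum>k\<in>S. M r k * G k l * M l j)) / c r"
        using r(1) assms(2) by (simp add: sum_subtractf sum.delta)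
      also have "(\<Sum>l\<in>R. \<Sum>k\<in>S. M r k * G k l * M l j) = (\<Sum>k\<in>S. \<Sum>l\<in>R. M r k * G k l * M l j)"
        by (rule sum.swap)
      finally show ?thesis .
    qed
    have "(\<Sum>k\<in>insert s S. \<Sum>l\<in>R. M i k * H k l * M l j) = M i j"
      if ij: "i \<in> R" "j \<in> insert s S" for i j
    proof -
      have "(\<Sum>k\<in>insert s S. \<Sum>l\<in>R. M i k * H k l * M l j) =
          M i s * (\<Sum>l\<in>R. h l * M l j) + (\<Sum>k\<in>S. \<Sum>l\<in>R. M i k * (G k l - g k * h l) * M l j)"
        using insert.hyps ne by (simp add: H_def sum_distrib_left mult.assoc)
      also have "(\<Sum>k\<in>S. \<Sum>l\<in>R. M i k * (G k l - g k * h l) * M l j) =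
          (\<Sum>k\<in>S. \<Sum>l\<in>R. M i k * G k l * M l j) - (\<Sum>k\<in>S. M i k * g k) * (\<Sum>l\<in>R. h l * M l j)"
        by (simp add: sum_product sum_subtractf algebra_simps)
      finally have eq: "(\<Sum>k\<in>insert s S. \<Sum>l\<in>R. M i k * H k l * M l j) =
          (\<Sum>k\<in>S. \<Sum>l\<in>R. M i k * G k l * M l j) + c i * (\<Sum>l\<in>R. h l * M l j)"
        by (simp add: c_def algebra_simps)
      show ?thesis
      proof (cases "j = s")
        case True
        have "(\<Sum>l\<in>R. h l * M l s) = 1"
          using r(2) unfolding hM Mg by (simp add: c_def)
        with eq True Mg show ?thesis by (simp add: c_def)
      next
        case False
        then show ?thesis using eq ij G hM r(1) by auto
      qed
    qed
    then show ?thesis by blast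
  qed
qed

section \<open>Algebra of matrices indexed by a vertex set\<close>

lemma mat_mult_assoc: "mat_mult V (mat_mult V A B) C = mat_mult V A (mat_mult V B C)"
proof (intro ext)
  fix i j
  have "mat_mult V (mat_mult V A B) C i j = (\<Sum>k\<in>V. \<Sum>l\<in>V. A i l * B l k * C k j)"
    by (simp add: mat_mult_def sum_distrib_right)
  also have "\<dots> = (\<Sum>l\<in>V. \<Sum>k\<in>V. A i l * B l k * C k j)"
    by (rule sum.swap)
  finally show "mat_mult V (mat_mult V A B) C i j = mat_mult V A (mat_mult V B C) i j"
    by (simp add: mat_mult_def sum_distrib_left mult.assoc)
qed

definition transp_mat :: "('v \<Rightarrow> 'v \<Rightarrow> real) \<Rightarrow> 'v \<Rightarrow> 'v \<Rightarrow> real" where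
  "transp_mat A i j = A j i"

text \<open>Fixing the irrelevant entries to 0 turns matrix identities on \<open>V\<close> into
  equations between functions, which can be used for rewriting.\<close>

definition supported_on :: "'v set \<Rightarrow> ('v \<Rightarrow> 'v \<Rightarrow> real) \<Rightarrow> bool" where
  "supported_on V A \<longleftrightarrow> (\<forall>i j. i \<notin> V \<or> j \<notin> V \<longrightarrow> A i j = 0)"

lemma transp_mat_transp_mat [simp]: "transp_mat (transp_mat A) = A"
  by (simp add: transp_mat_def fun_eq_iff)

lemma transp_mat_mult: "transp_mat (mat_mult V A B) = mat_mult V (transp_mat B) (transp_mat A)"
  by (simp add: transp_mat_def mat_mult_def fun_eq_iff mult.commute)

lemma transp_mat_eq_iff: "transp_mat A = transp_mat B \<longleftrightarrow> A = B"
  by (auto simp: transp_mat_def fun_eq_iff)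

lemma supported_on_mat_mult:
  "supported_on V A \<Longrightarrow> supported_on V B \<Longrightarrow> supported_on V (mat_mult V A B)"
  by (auto simp: supported_on_def mat_mult_def)

lemma supported_on_eqI:
  assumes "supported_on V A" "supported_on V B" "\<And>i j. i \<in> V \<Longrightarrow> j \<in> V \<Longrightarrow> A i j = B i j"
  shows "A = B"
proof (intro ext)
  fix i j
  show "A i j = B i j"
    using assms unfolding supported_on_def by (cases "i \<in> V \<and> j \<in> V") simp_all
qed

text \<open>A real symmetric matrix satisfies \<open>ker (A A) = ker A\<close>: for a column
  \<open>z\<close> of \<open>X - Y\<close> and \<open>w = A z\<close>, the hypothesis gives
  \<open>A w = 0\<close>, so the squared norm of \<open>w\<close> is the inner product of
  \<open>z\<close> with \<open>A w\<close>, which vanishes.\<close>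

lemma symmetric_cancel_left:
  assumes fin: "finite V" and sup: "supported_on V A" and sym: "transp_mat A = A"
    and eq: "mat_mult V A (mat_mult V A X) = mat_mult V A (mat_mult V A Y)"
  shows "mat_mult V A X = mat_mult V A Y"
proof (intro ext)
  fix i j
  define z where "z k = X k j - Y k j" for k
  define w where "w k = (\<Sum>l\<in>V. A k l * z l)" for k
  have w: "w k = mat_mult V A X k j - mat_mult V A Y k j" for k
    by (simp add: w_def z_def mat_mult_def right_diff_distrib sum_subtractf)
  have Aw: "(\<Sum>l\<in>V. A k l * w l) = 0" for k
    using fun_cong[OF fun_cong[OF eq, of k], of j]
    by (simp add: w mat_mult_def[of V A "mat_mult V A X"] mat_mult_def[of V A "mat_mult V A Y"]
        right_diff_distrib sum_subtractf)
  have "(\<Sum>k\<in>V. w k * w k) = (\<Sum>k\<in>V. \<Sum>l\<in>V. w k * (A k l * z l))"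
    by (simp add: w_def[of "_ :: 'a"] sum_distrib_left sum_distrib_right)
  also have "\<dots> = (\<Sum>l\<in>V. \<Sum>k\<in>V. w k * (A k l * z l))"
    by (rule sum.swap)
  also have "\<dots> = (\<Sum>l\<in>V. z l * (\<Sum>k\<in>V. A l k * w k))"
  proof -
    have "A k l = A l k" for k l
      using fun_cong[OF fun_cong[OF sym, of l], of k] by (simp add: transp_mat_def)
    then show ?thesis
      by (auto simp: sum_distrib_left algebra_simps intro!: sum.cong)
  qed
  finally have "(\<Sum>k\<in>V. w k * w k) = 0"
    by (simp add: Aw)
  then have "\<forall>k\<in>V. w k = 0"
    using fin by (simp add: sum_nonneg_eq_0_iff)
  then show "mat_mult V A X i j = mat_mult V A Y i j"
    using w sup by (cases "i \<in> V") (auto simp: supported_on_def mat_mult_def)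
qed

lemma symmetric_cancel_right:
  assumes "finite V" "supported_on V A" "transp_mat A = A"
    and "mat_mult V (mat_mult V X A) A = mat_mult V (mat_mult V Y A) A"
  shows "mat_mult V X A = mat_mult V Y A"
proof -
  have "mat_mult V A (mat_mult V A (transp_mat X)) = mat_mult V A (mat_mult V A (transp_mat Y))"
    using assms(4)[THEN arg_cong[where f = transp_mat]] assms(3) by (simp add: transp_mat_mult)
  from symmetric_cancel_left[OF assms(1-3) this]
  show ?thesis
    using assms(3) transp_mat_mult transp_mat_eq_iff by metis
qed

lemma is_pseudoinverse_iff:
  assumes "supported_on V A"
  shows "is_pseudoinverse V A B \<longleftrightarrow> supported_on V B \<and>
     mat_mult V (mat_mult V A B) A = A \<and> mat_mult V (mat_mult V B A) B = B \<and>
     transp_mat (mat_mult V A B) = mat_mult V A B \<and> transp_mat (mat_mult V B A) = mat_mult V B A"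
proof (cases "supported_on V B")
  case True
  have ext: "A' = B' \<longleftrightarrow> (\<forall>i\<in>V. \<forall>j\<in>V. A' i j = B' i j)" if "supported_on V A'" "supported_on V B'" for A' B'
    using supported_on_eqI[OF that] by auto
  have tr: "supported_on V (transp_mat C)" if "supported_on V C" for C
    using that by (auto simp: supported_on_def transp_mat_def)
  show ?thesis
    unfolding is_pseudoinverse_def using True assms
    by (simp add: ext tr supported_on_mat_mult) (auto simp: supported_on_def transp_mat_def)
next
  case False
  then show ?thesis
    unfolding is_pseudoinverse_def supported_on_def by blast
qed

text \<open>
  If \<open>G\<close> is a generalized inverse of \<open>A\<^sup>3\<close>, then \<open>A G A\<close> is the pseudoinverse of \<open>A\<close>: cancelling
  factors \<open>A\<close> in \<open>A\<^sup>3 G A\<^sup>3 = A\<^sup>3\<close> leaves \<open>(A G A) A\<^sup>2 = A = A\<^sup>2 (A G A)\<close>.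
\<close>

lemma symmetric_pseudoinverse_exists:
  assumes fin: "finite V" and sup: "supported_on V A" and sym: "transp_mat A = A"
  shows "\<exists>B. is_pseudoinverse V A B \<and> transp_mat B = B"
proof -
  let ?m = "mat_mult V"
  \<comment> \<open>The identity on \<open>V\<close> lets a bare factor \<open>A\<close> be written
    as a product, so that the cancellation lemmas can also strip the last factor.\<close>
  define I :: "'a \<Rightarrow> 'a \<Rightarrow> real" where "I i j = (if i = j \<and> i \<in> V then 1 else 0)" for i j
  have I: "?m A I = A" "?m I A = A"
  proof -
    have "(\<Sum>k\<in>V. A i k * I k j) = A i j" "(\<Sum>k\<in>V. I i k * A k j) = A i j" for i j
    proof -
      have "(\<Sum>k\<in>V. A i k * I k j) = (\<Sum>k\<in>V. if k = j then A i j else 0)"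
        by (intro sum.cong) (auto simp: I_def)
      then show "(\<Sum>k\<in>V. A i k * I k j) = A i j"
        using sup fin by (auto simp: supported_on_def)
      have "(\<Sum>k\<in>V. I i k * A k j) = (\<Sum>k\<in>V. if k = i then A i j else 0)"
        by (intro sum.cong) (auto simp: I_def)
      then show "(\<Sum>k\<in>V. I i k * A k j) = A i j"
        using sup fin by (auto simp: supported_on_def)
    qed
    then show "?m A I = A" "?m I A = A"
      by (simp_all add: fun_eq_iff mat_mult_def)
  qed
  define A3 where "A3 = ?m A (?m A A)"
  obtain G0 where G0: "\<And>i j. i \<in> V \<Longrightarrow> j \<in> V \<Longrightarrow> (\<Sum>k\<in>V. \<Sum>l\<in>V. A3 i k * G0 k l * A3 l j) = A3 i j"
    using generalized_inverse_exists[OF fin fin, of A3] by blast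
  define G where "G i j = (if i \<in> V \<and> j \<in> V then G0 i j else 0)" for i j
  have supG: "supported_on V G" by (simp add: supported_on_def G_def)
  have sup3: "supported_on V A3" unfolding A3_def by (intro supported_on_mat_mult sup)
  have "?m A3 (?m G A3) = A3"
  proof (rule supported_on_eqI)
    fix i j assume "i \<in> V" "j \<in> V"
    then show "?m A3 (?m G A3) i j = A3 i j"
      using G0[of i j] by (simp add: mat_mult_def G_def sum_distrib_left mult.assoc)
  qed (intro supported_on_mat_mult supG sup3)+
  then have G: "?m A (?m A (?m A (?m G (?m A (?m A A))))) = ?m A (?m A A)"
    by (simp add: A3_def mat_mult_assoc)
  note cl = symmetric_cancel_left[OF fin sup sym] and cr = symmetric_cancel_right[OF fin sup sym]
  define B where "B = ?m A (?m G A)"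
  have supB: "supported_on V B" unfolding B_def by (intro supported_on_mat_mult sup supG)
  have "?m A (?m A (?m G (?m A (?m A A)))) = ?m A A"
    using cl[of "?m A (?m G (?m A (?m A A)))" A] G by simp
  then have "?m A (?m G (?m A (?m A A))) = A"
    using cl[of "?m G (?m A (?m A A))" I] I by simp
  then have BAA: "?m B (?m A A) = A"
    by (simp add: B_def mat_mult_assoc)
  have "?m A (?m A (?m A (?m G (?m A A)))) = ?m A A"
    using cr[of "?m A (?m A (?m A (?m G A)))" A] G by (simp add: mat_mult_assoc)
  then have "?m A (?m A (?m A (?m G A))) = A"
    using cr[of "?m A (?m A (?m A G))" I] I by (simp add: mat_mult_assoc)
  then have AAB: "?m A (?m A B) = A"
    by (simp add: B_def mat_mult_assoc)
  \<comment> \<open>Both sides equal \<open>B A A B\<close>.\<close>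
  have comm: "?m A B = ?m B A"
    using BAA AAB by (metis mat_mult_assoc)
  have ABA: "?m (?m A B) A = A"
    using AAB comm by (metis mat_mult_assoc)
  have BAB: "?m (?m B A) B = B"
    using BAA by (metis B_def mat_mult_assoc)
  \<comment> \<open>Transposing \<open>A A B = A\<close> gives \<open>T A A = A\<close>. Then
    \<open>A B\<close> and \<open>T A\<close> both equal \<open>T A A B\<close>, so
    \<open>A B\<close> is symmetric. Finally
    \<open>T = T A T = A B T = B A T = B B A = B A B = B\<close>.\<close>
  define T where "T = transp_mat B"
  have TAA: "?m T (?m A A) = A"
    using AAB[THEN arg_cong[where f = transp_mat]] sym by (simp add: transp_mat_mult T_def mat_mult_assoc)
  have ABTA: "?m A B = ?m T A"
    using TAA AAB by (metis mat_mult_assoc)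
  have AB: "transp_mat (?m A B) = ?m A B"
    using ABTA sym by (simp add: transp_mat_mult T_def)
  have AT: "?m A T = ?m B A"
    using AB comm sym by (metis transp_mat_mult T_def)
  have TAT: "?m (?m T A) T = T"
    using BAB[THEN arg_cong[where f = transp_mat]] sym by (simp add: transp_mat_mult T_def mat_mult_assoc)
  have "T = B"
    using TAT BAB AT ABTA comm by (metis mat_mult_assoc)
  then have "transp_mat B = B" by (simp add: T_def)
  moreover have "is_pseudoinverse V A B"
    using supB ABA BAB AB comm by (simp add: is_pseudoinverse_iff[OF sup])
  ultimately show ?thesis by blast
qed

text \<open>Penrose's argument: \<open>A B = (A C) (A B)\<close> is symmetric, so it equals its
  transpose \<open>(A B) (A C) = A C\<close>. Likewise \<open>B A = C A\<close>, whence
  \<open>B = B A B = B A C = C A C = C\<close>.\<close>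

lemma pseudoinverse_unique:
  assumes sup: "supported_on V A" and B: "is_pseudoinverse V A B" and C: "is_pseudoinverse V A C"
  shows "B = C"
proof -
  let ?m = "mat_mult V"
  note B' = B[unfolded is_pseudoinverse_iff[OF sup]] and C' = C[unfolded is_pseudoinverse_iff[OF sup]]
  have "?m A B = transp_mat (?m (?m A C) (?m A B))"
    using B' C' by (metis mat_mult_assoc)
  also have "\<dots> = ?m (?m A B) (?m A C)"
    using B' C' by (simp add: transp_mat_mult)
  finally have 1: "?m A B = ?m A C"
    using B' by (metis mat_mult_assoc)
  have "?m B A = transp_mat (?m (?m B A) (?m C A))"
    using B' C' by (metis mat_mult_assoc)
  also have "\<dots> = ?m (?m C A) (?m B A)"
    using B' C' by (simp add: transp_mat_mult)
  finally have 2: "?m B A = ?m C A"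
    using B' C' by (metis mat_mult_assoc)
  show ?thesis
    using 1 2 B' C' by (metis mat_mult_assoc)
qed

text \<open>Existence and uniqueness make the definite description proper. Symmetry is recorded
  because the energy identity moves the pseudoinverse across an inner product.\<close>

lemma symmetric_pseudoinverse:
  assumes "finite V" "supported_on V A" "transp_mat A = A"
  shows "is_pseudoinverse V A (pseudoinverse V A)" "transp_mat (pseudoinverse V A) = pseudoinverse V A"
proof -
  obtain B where B: "is_pseudoinverse V A B" "transp_mat B = B"
    using symmetric_pseudoinverse_exists[OF assms] by blast
  then have "pseudoinverse V A = B"
    unfolding pseudoinverse_def using pseudoinverse_unique[OF assms(2)] by (intro the_equality) blast+
  with B show "is_pseudoinverse V A (pseudoinverse V A)" "transp_mat (pseudoinverse V A) = pseudoinverse V A"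
    by auto
qed

section \<open>Effective resistance and Dirichlet energy\<close>

lemma supported_on_laplacian: "supported_on V (laplacian V E)"
  by (auto simp: supported_on_def laplacian_def degree_matrix_def adjacency_matrix_def)

lemma transp_mat_laplacian: "transp_mat (laplacian V E) = laplacian V E"
  by (auto simp: transp_mat_def laplacian_def degree_matrix_def adjacency_matrix_def fun_eq_iff insert_commute)

lemma sum_edges_at_vertex:
  assumes "\<And>e. e \<in> E \<Longrightarrow> \<exists>a\<in>V. \<exists>b\<in>V. a \<noteq> b \<and> e = {a, b}" and "i \<in> V"
  shows "(\<Sum>j\<in>nbrs V E i. f {j, i}) = (\<Sum>e\<in>{e \<in> E. i \<in> e}. f e)"
proof (rule sum.reindex_bij_betw)
  show "bij_betw (\<lambda>j. {j, i}) (nbrs V E i) {e \<in> E. i \<in> e}"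
    unfolding bij_betw_def
  proof
    show "inj_on (\<lambda>j. {j, i}) (nbrs V E i)"
      by (auto simp: inj_on_def doubleton_eq_iff)
    show "(\<lambda>j. {j, i}) ` nbrs V E i = {e \<in> E. i \<in> e}"
    proof (intro equalityI subsetI)
      fix e assume e: "e \<in> {e \<in> E. i \<in> e}"
      then obtain a b where ab: "a \<in> V" "b \<in> V" "e = {a, b}" using assms(1) by blast
      then obtain j where j: "j \<in> V" "e = {j, i}" using e by auto
      then have "j \<in> nbrs V E i" using e by (simp add: nbrs_def)
      with j(2) show "e \<in> (\<lambda>j. {j, i}) ` nbrs V E i" by (rule image_eqI)
    qed (auto simp: nbrs_def)
  qed
qed

lemma laplacian_mult_vector:
  assumes "finite V" "i \<in> V"
  shows "(\<Sum>j\<in>V. laplacian V E i j * \<phi> j) = (\<Sum>j\<in>nbrs V E i. \<phi> i - \<phi> j)"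
proof -
  have "(\<Sum>j\<in>V. laplacian V E i j * \<phi> j) =
      (\<Sum>j\<in>V. (if j = i then real (card (nbrs V E i)) * \<phi> i else 0) - (if {j, i} \<in> E then \<phi> j else 0))"
    using assms by (intro sum.cong) (auto simp: laplacian_def degree_matrix_def adjacency_matrix_def insert_commute algebra_simps)
  also have "\<dots> = real (card (nbrs V E i)) * \<phi> i - (\<Sum>j\<in>V. if {j, i} \<in> E then \<phi> j else 0)"
    using assms by (simp add: sum_subtractf)
  also have "(\<Sum>j\<in>V. if {j, i} \<in> E then \<phi> j else 0) = (\<Sum>j\<in>nbrs V E i. \<phi> j)"
    using assms(1) by (simp add: nbrs_def sum.inter_filter)
  finally show ?thesis by (simp add: sum_subtractf)
qed

text \<open>Adding the double sum to its copy with the two ends exchanged gives a squared difference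
  for every ordered adjacent pair, hence each edge twice.\<close>

lemma laplacian_quadratic_form:
  assumes fin: "finite V" "finite E"
    and E: "\<And>e. e \<in> E \<Longrightarrow> \<exists>a\<in>V. \<exists>b\<in>V. a \<noteq> b \<and> e = {a, b}"
  shows "(\<Sum>i\<in>V. \<Sum>j\<in>V. \<phi> i * laplacian V E i j * \<phi> j) = (\<Sum>e\<in>E. (osc \<phi> e)\<^sup>2)"
proof -
  let ?Q = "\<Sum>i\<in>V. \<Sum>j\<in>V. \<phi> i * laplacian V E i j * \<phi> j"
  have Q1: "?Q = (\<Sum>i\<in>V. \<Sum>j\<in>nbrs V E i. \<phi> i * (\<phi> i - \<phi> j))"
    using laplacian_mult_vector[OF fin(1)] by (simp add: mult.assoc flip: sum_distrib_left)
  also have "\<dots> = (\<Sum>j\<in>V. \<Sum>i\<in>nbrs V E j. \<phi> i * (\<phi> i - \<phi> j))"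
    unfolding nbrs_def using sum.swap_restrict[OF fin(1) fin(1), of "\<lambda>i j. \<phi> i * (\<phi> i - \<phi> j)" "\<lambda>i j. {j, i} \<in> E"]
    by (simp add: insert_commute)
  finally have Q2: "?Q = (\<Sum>i\<in>V. \<Sum>j\<in>nbrs V E i. \<phi> j * (\<phi> j - \<phi> i))" .
  have "2 * ?Q = (\<Sum>i\<in>V. \<Sum>j\<in>nbrs V E i. \<phi> i * (\<phi> i - \<phi> j) + \<phi> j * (\<phi> j - \<phi> i))"
    using Q1 Q2 by (simp add: sum.distrib)
  also have "\<dots> = (\<Sum>i\<in>V. \<Sum>j\<in>nbrs V E i. (osc \<phi> {j, i})\<^sup>2)"
    by (intro sum.cong refl) (simp add: osc_doubleton power2_eq_square algebra_simps)
  also have "\<dots> = (\<Sum>i\<in>V. \<Sum>e\<in>{e \<in> E. i \<in> e}. (osc \<phi> e)\<^sup>2)"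
    by (intro sum.cong refl sum_edges_at_vertex E)
  also have "\<dots> = (\<Sum>e\<in>E. \<Sum>i\<in>{i \<in> V. i \<in> e}. (osc \<phi> e)\<^sup>2)"
    by (rule sum.swap_restrict[OF fin])
  also have "\<dots> = (\<Sum>e\<in>E. 2 * (osc \<phi> e)\<^sup>2)"
  proof (intro sum.cong refl)
    fix e assume "e \<in> E"
    from E[OF this] obtain a b where "a \<in> V" "b \<in> V" "a \<noteq> b" "e = {a, b}" by blast
    then have "{i \<in> V. i \<in> e} = {a, b}" "card {a, b} = 2" by auto
    then show "(\<Sum>i\<in>{i \<in> V. i \<in> e}. (osc \<phi> e)\<^sup>2) = 2 * (osc \<phi> e)\<^sup>2" by simp
  qed
  finally show ?thesis by (simp flip: sum_distrib_left)
qed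

text \<open>With \<open>B\<close> the pseudoinverse, \<open>b\<close> the difference of indicators
  and \<open>\<phi> = B b\<close>, the resistance is the inner product of \<open>b\<close> and
  \<open>\<phi>\<close>. The energy of \<open>\<phi>\<close> is the form of \<open>B L B\<close> at
  \<open>b\<close>, as \<open>B\<close> is symmetric, and \<open>B L B = B\<close>.\<close>

lemma effective_resistance_potential:
  assumes fin: "finite V" "finite E"
    and E: "\<And>e. e \<in> E \<Longrightarrow> \<exists>a\<in>V. \<exists>b\<in>V. a \<noteq> b \<and> e = {a, b}"
    and uv: "u \<in> V" "v \<in> V"
  obtains \<phi> where "effective_resistance V E u v = \<phi> u - \<phi> v"
    "effective_resistance V E u v = (\<Sum>e\<in>E. (osc \<phi> e)\<^sup>2)"
proof -
  let ?m = "mat_mult V" and ?L = "laplacian V E" and ?r = "effective_resistance V E u v"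
  define B where "B = pseudoinverse V ?L"
  note pinv = symmetric_pseudoinverse[OF fin(1) supported_on_laplacian transp_mat_laplacian, of E, folded B_def]
  have BLB: "?m B (?m ?L B) = B"
    using pinv(1) by (simp add: is_pseudoinverse_iff[OF supported_on_laplacian] mat_mult_assoc)
  define b :: "'a \<Rightarrow> real" where "b i = indicator {u} i - indicator {v} i" for i
  \<comment> \<open>The vector \<open>b\<close> is encoded as a matrix with all columns equal, so
    that the laws of \<open>mat_mult\<close> apply; any column index, here \<open>u\<close>, reads
    it off.\<close>
  define bm :: "'a \<Rightarrow> 'a \<Rightarrow> real" where "bm i j = b i" for i j
  define \<phi> where "\<phi> i = ?m B bm i u" for i
  have \<phi>: "\<phi> i = ?m B bm i j" for i j
    by (simp add: \<phi>_def mat_mult_def bm_def)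
  have "?r = (\<Sum>i\<in>V. b i * \<phi> i)"
    by (simp add: effective_resistance_def B_def b_def \<phi>_def bm_def mat_mult_def sum_distrib_left mult.assoc)
  also have "\<dots> = (\<Sum>i\<in>V. (if i = u then \<phi> i else 0) - (if i = v then \<phi> i else 0))"
    by (intro sum.cong) (auto simp: b_def)
  also have "\<dots> = \<phi> u - \<phi> v"
    using fin(1) uv by (simp add: sum_subtractf)
  finally have 1: "?r = \<phi> u - \<phi> v" .
  have "(\<Sum>i\<in>V. \<Sum>j\<in>V. \<phi> i * ?L i j * \<phi> j) = ?m (transp_mat (?m B bm)) (?m ?L (?m B bm)) u u"
    by (simp add: mat_mult_def[of V "transp_mat (?m B bm)"] mat_mult_def[of V ?L] transp_mat_def
        sum_distrib_left mult.assoc flip: \<phi>)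
  also have "\<dots> = ?m (transp_mat bm) (?m B (?m ?L (?m B bm))) u u"
    using pinv(2) by (simp add: transp_mat_mult mat_mult_assoc)
  also have "\<dots> = ?m (transp_mat bm) (?m B bm) u u"
    using BLB by (metis mat_mult_assoc)
  also have "\<dots> = (\<Sum>i\<in>V. b i * \<phi> i)"
    by (simp add: mat_mult_def[of V "transp_mat bm"] transp_mat_def bm_def[of _ u] flip: \<phi>)
  also have "\<dots> = ?r"
    by (fact \<open>?r = (\<Sum>i\<in>V. b i * \<phi> i)\<close>[symmetric])
  finally have "?r = (\<Sum>e\<in>E. (osc \<phi> e)\<^sup>2)"
    using laplacian_quadratic_form[OF fin E, of \<phi>] by simp
  with 1 show thesis by (rule that)
qed

text \<open>The parallel law: the edge \<open>uv\<close> and the disjoint remainders of the cycles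
  have total energy at least \<open>r\<^sup>2\<close> times the sum of their conductances, while the
  energy of the whole graph is only \<open>r\<close>.\<close>

lemma effective_resistance_le_parallel_cycles:
  assumes fin: "finite V" "finite E"
    and E: "\<And>e. e \<in> E \<Longrightarrow> \<exists>a\<in>V. \<exists>b\<in>V. a \<noteq> b \<and> e = {a, b}"
    and I: "finite I" "\<And>i. i \<in> I \<Longrightarrow> two_regular (F i)" "\<And>i. i \<in> I \<Longrightarrow> F i \<subseteq> E" "\<And>i. i \<in> I \<Longrightarrow> {u, v} \<in> F i"
    and disj: "\<And>i j. i \<in> I \<Longrightarrow> j \<in> I \<Longrightarrow> i \<noteq> j \<Longrightarrow> F i \<inter> F j = {{u, v}}"
    and uv: "{u, v} \<in> E"
  shows "effective_resistance V E u v \<le> 1 / (1 + (\<Sum>i\<in>I. 1 / (real (card (F i)) - 1)))"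
proof -
  let ?r = "effective_resistance V E u v"
  have uvV: "u \<in> V" "v \<in> V" using E[OF uv] by (auto simp: doubleton_eq_iff)
  obtain \<phi> where \<phi>: "?r = \<phi> u - \<phi> v" "?r = (\<Sum>e\<in>E. (osc \<phi> e)\<^sup>2)"
    using effective_resistance_potential[OF fin E uvV] by blast
  \<comment> \<open>The two edges at \<open>u\<close> already give 2, so every
    \<open>card (F i) - 1\<close> is positive.\<close>
  have card: "card (F i) \<ge> 2" if "i \<in> I" for i
  proof -
    have "card {e \<in> F i. u \<in> e} = 2" "finite (F i)"
      using I(2)[OF that] I(4)[OF that] unfolding two_regular_def by blast+
    then show ?thesis using card_mono[of "F i" "{e \<in> F i. u \<in> e}"] by auto
  qed
  have cyc: "?r\<^sup>2 * (1 / (real (card (F i)) - 1)) \<le> (\<Sum>e\<in>F i - {{u, v}}. (osc \<phi> e)\<^sup>2)" if "i \<in> I" for i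
    using two_regular_osc_sum_squares[OF I(2)[OF that] I(4)[OF that], of \<phi>] card[OF that]
    unfolding \<phi>(1)[symmetric] by (simp add: of_nat_diff field_simps)
  have "?r\<^sup>2 * (1 + (\<Sum>i\<in>I. 1 / (real (card (F i)) - 1))) =
      (osc \<phi> {u, v})\<^sup>2 + (\<Sum>i\<in>I. ?r\<^sup>2 * (1 / (real (card (F i)) - 1)))"
    by (simp add: distrib_left sum_distrib_left osc_doubleton \<phi>(1))
  also have "\<dots> \<le> (osc \<phi> {u, v})\<^sup>2 + (\<Sum>i\<in>I. \<Sum>e\<in>F i - {{u, v}}. (osc \<phi> e)\<^sup>2)"
    using cyc by (intro add_left_mono sum_mono)
  also have "(\<Sum>i\<in>I. \<Sum>e\<in>F i - {{u, v}}. (osc \<phi> e)\<^sup>2) = (\<Sum>e\<in>(\<Union>i\<in>I. F i - {{u, v}}). (osc \<phi> e)\<^sup>2)"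
  proof (rule sum.UNION_disjoint[symmetric])
    show "\<forall>i\<in>I. finite (F i - {{u, v}})" using I(2) by (simp add: two_regular_def)
    show "\<forall>i\<in>I. \<forall>j\<in>I. i \<noteq> j \<longrightarrow> (F i - {{u, v}}) \<inter> (F j - {{u, v}}) = {}" using disj by blast
  qed (rule I)
  also have "\<dots> \<le> (\<Sum>e\<in>E - {{u, v}}. (osc \<phi> e)\<^sup>2)"
    using fin I(3) by (intro sum_mono2) auto
  also have "(osc \<phi> {u, v})\<^sup>2 + (\<Sum>e\<in>E - {{u, v}}. (osc \<phi> e)\<^sup>2) = ?r"
    using sum.remove[OF fin(2) uv, of "\<lambda>e. (osc \<phi> e)\<^sup>2"] \<phi>(2) by simp
  finally have main: "?r\<^sup>2 * (1 + (\<Sum>i\<in>I. 1 / (real (card (F i)) - 1))) \<le> ?r" by simp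
  have pos: "1 + (\<Sum>i\<in>I. 1 / (real (card (F i)) - 1)) > 0"
    using card by (intro add_pos_nonneg sum_nonneg) fastforce+
  show ?thesis
  \<comment> \<open>Cancelling one factor \<open>r\<close> needs \<open>r > 0\<close>; otherwise the
    positive right-hand side bounds it at once.\<close>
  proof (cases "?r > 0")
    case True
    with main have "?r * (1 + (\<Sum>i\<in>I. 1 / (real (card (F i)) - 1))) \<le> 1"
      by (simp add: power2_eq_square mult.assoc)
    with pos show ?thesis by (simp add: field_simps)
  next
    case False
    then have "?r \<le> 0" by simp
    also have "0 \<le> 1 / (1 + (\<Sum>i\<in>I. 1 / (real (card (F i)) - 1)))"
      using pos by simp
    finally show ?thesis .
  qed
qed

section \<open>Faces of polytopes\<close>

text \<open>
  Modulo the direction space of the ridge, three points \<open>y1\<close>, \<open>y2\<close>, \<open>y3\<close> of the three facets are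
  linearly dependent, since the quotient is a plane.  The functional supporting one facet kills one of
  these vectors and is negative on the other two, which contradicts any sign pattern of the coefficients.
\<close>

lemma facets_through_ridge_at_most_two:
  fixes S :: "'a::euclidean_space set"
  assumes S: "polyhedron S" and R: "R face_of S" "R \<noteq> {}" "aff_dim R = aff_dim S - 2"
    and F: "F1 facet_of S" "F2 facet_of S" "F3 facet_of S" "R \<subseteq> F1" "R \<subseteq> F2" "R \<subseteq> F3"
    and ne: "F1 \<noteq> F2" "F1 \<noteq> F3" "F2 \<noteq> F3"
  shows False
proof -
  have conv: "convex S" using S by (rule polyhedron_imp_convex)
  \<comment> \<open>Otherwise the face \<open>F \<inter> G\<close> would have dimension strictly
    between those of \<open>R\<close> and \<open>F\<close>, which differ by 1.\<close>
  have Int: "F \<inter> G = R" if "F facet_of S" "G facet_of S" "R \<subseteq> F" "R \<subseteq> G" "F \<noteq> G" for F G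
  proof (rule ccontr)
    assume "F \<inter> G \<noteq> R"
    have FG: "F face_of S" "G face_of S" and d: "aff_dim F = aff_dim S - 1" "aff_dim G = aff_dim S - 1"
      using that by (auto simp: facet_of_def)
    have face: "F \<inter> G face_of S" using FG by (rule face_of_Int)
    then have "R face_of F \<inter> G"
      using R(1) that face_of_face by blast
    then have "aff_dim R < aff_dim (F \<inter> G)"
      using \<open>F \<inter> G \<noteq> R\<close> by (intro face_of_aff_dim_lt[OF face_of_imp_convex[OF face]]) auto
    have "F \<inter> G \<noteq> F"
    proof
      assume "F \<inter> G = F"
      then have "F face_of G" using FG face_of_face by blast
      then have "aff_dim F < aff_dim G"
        using \<open>F \<noteq> G\<close> by (rule face_of_aff_dim_lt[OF face_of_imp_convex[OF FG(2)]])
      with d show False by simp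
    qed
    moreover have "F \<inter> G face_of F"
      using face face_of_face[OF FG(1)] by simp
    ultimately have "aff_dim (F \<inter> G) < aff_dim F"
      using face_of_aff_dim_lt[OF face_of_imp_convex[OF FG(1)]] by blast
    with \<open>aff_dim R < aff_dim (F \<inter> G)\<close> show False using d R by linarith
  qed
  have ex: "\<exists>y. y \<in> F - R" if "F facet_of S" "R \<subseteq> F" for F
  proof (rule ccontr)
    assume "\<nexists>y. y \<in> F - R"
    then have "aff_dim F \<le> aff_dim R" by (intro aff_dim_subset) auto
    with that R(3) show False by (simp add: facet_of_def)
  qed
  obtain y1 y2 y3 where y: "y1 \<in> F1 - R" "y2 \<in> F2 - R" "y3 \<in> F3 - R"
    using ex F by meson
  obtain x where x: "x \<in> R" using R(2) by blast
  have sub: "F1 \<subseteq> S" "F2 \<subseteq> S" "F3 \<subseteq> S" using F by (auto dest: facet_of_imp_subset)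
  have y1: "y1 \<notin> affine hull R"
    using face_of_imp_eq_affine_Int[OF conv R(1)] y sub by blast
  have "affine hull (insert y1 R) \<subseteq> affine hull F1"
    using y F by (intro hull_mono) auto
  moreover have "y2 \<notin> affine hull F1"
  proof
    assume "y2 \<in> affine hull F1"
    then have "y2 \<in> affine hull F1 \<inter> S" using y sub by auto
    then have "y2 \<in> F1"
      using face_of_imp_eq_affine_Int[OF conv facet_of_imp_face_of[OF F(1)]] by simp
    then show False using Int[OF F(1,2,4,5) ne(1)] y by auto
  qed
  ultimately have y2: "y2 \<notin> affine hull (insert y1 R)" by blast
  \<comment> \<open>Each of \<open>y1\<close> and \<open>y2\<close> raises the dimension by one, so
    together with \<open>R\<close> they affinely span \<open>S\<close>. Translating by
    \<open>x\<close> then expresses \<open>y3 - x\<close> through \<open>y2 - x\<close> and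
    \<open>y1 - x\<close> modulo the directions of \<open>R\<close>.\<close>
  have "insert y2 (insert y1 R) \<subseteq> S"
    using y sub F by auto
  moreover have "aff_dim (insert y2 (insert y1 R)) = aff_dim S"
    using y1 y2 R(3) by (simp add: aff_dim_insert)
  ultimately have "affine hull (insert y2 (insert y1 R)) = affine hull S"
    by (simp add: aff_dim_eq_full_gen)
  moreover have "insert x (insert y2 (insert y1 R)) = insert y2 (insert y1 R)"
    using x by auto
  moreover have "y3 \<in> affine hull S"
    using y sub by (auto intro: hull_inc)
  ultimately have "y3 \<in> affine hull (insert x (insert y2 (insert y1 R)))"
    by simp
  then have "y3 - x \<in> span (insert (y2 - x) (insert (y1 - x) ((\<lambda>z. - x + z) ` R)))"
    unfolding affine_hull_insert_span_gen by auto
  then obtain c2 c1 where c: "(y3 - x) - c2 *\<^sub>R (y2 - x) - c1 *\<^sub>R (y1 - x) \<in> span ((\<lambda>z. - x + z) ` R)"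
    by (auto simp: span_breakdown_eq)
  \<comment> \<open>The normal of the hyperplane that cuts out the facet \<open>F\<close>, with
    values taken relative to \<open>x \<in> R\<close>.\<close>
  have fn: "\<exists>a. (\<forall>w \<in> span ((\<lambda>z. - x + z) ` R). a \<bullet> w = 0) \<and> (\<forall>z\<in>F. a \<bullet> (z - x) = 0) \<and> (\<forall>z\<in>S - F. a \<bullet> (z - x) < 0)"
    if FF: "F facet_of S" "R \<subseteq> F" for F
  proof -
    obtain a b where ab: "a \<noteq> 0" "S \<subseteq> {x. a \<bullet> x \<le> b}" "F = S \<inter> {x. a \<bullet> x = b}"
      using facet_of_polyhedron[OF S FF(1)] by blast
    have xb: "a \<bullet> x = b" using x FF ab by auto
    have "a \<bullet> w = 0" if "w \<in> span ((\<lambda>z. - x + z) ` R)" for w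
      using that
    proof (induction rule: span_induct)
      case base
      then show ?case by (simp add: subspace_hyperplane)
    next
      case (step w)
      then show ?case using ab FF xb by (auto simp: inner_diff_right)
    qed
    moreover have "a \<bullet> (z - x) = 0" if "z \<in> F" for z
      using that ab(3) xb by (simp add: inner_diff_right)
    moreover have "a \<bullet> (z - x) < 0" if "z \<in> S - F" for z
      using that ab(2,3) xb by (auto simp: inner_diff_right less_le)
    ultimately show ?thesis by blast
  qed
  have out: "y1 \<in> S - F2" "y1 \<in> S - F3" "y2 \<in> S - F1" "y2 \<in> S - F3" "y3 \<in> S - F1" "y3 \<in> S - F2"
    using y sub Int[OF F(1,2,4,5) ne(1)] Int[OF F(1,3,4,6) ne(2)] Int[OF F(2,3,5,6) ne(3)] by auto
  have eq0: "a \<bullet> (y3 - x) - c2 * (a \<bullet> (y2 - x)) - c1 * (a \<bullet> (y1 - x)) = 0"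
    if "\<forall>w \<in> span ((\<lambda>z. - x + z) ` R). a \<bullet> w = 0" for a
    using bspec[OF that c] by (simp only: inner_diff_right[of _ _ "_ *\<^sub>R _"] inner_scaleR_right)
  obtain a1 where a1: "\<forall>w \<in> span ((\<lambda>z. - x + z) ` R). a1 \<bullet> w = 0"
      "a1 \<bullet> (y1 - x) = 0" "a1 \<bullet> (y2 - x) < 0" "a1 \<bullet> (y3 - x) < 0"
    using fn[OF F(1) F(4)] y out by blast
  obtain a2 where a2: "\<forall>w \<in> span ((\<lambda>z. - x + z) ` R). a2 \<bullet> w = 0"
      "a2 \<bullet> (y2 - x) = 0" "a2 \<bullet> (y1 - x) < 0" "a2 \<bullet> (y3 - x) < 0"
    using fn[OF F(2) F(5)] y out by blast
  obtain a3 where a3: "\<forall>w \<in> span ((\<lambda>z. - x + z) ` R). a3 \<bullet> w = 0"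
      "a3 \<bullet> (y3 - x) = 0" "a3 \<bullet> (y1 - x) < 0" "a3 \<bullet> (y2 - x) < 0"
    using fn[OF F(3) F(6)] y out by blast
  \<comment> \<open>Under \<open>a1\<close> the relation leaves only \<open>y3\<close> and
    \<open>y2\<close>, both negative, which forces \<open>c2 > 0\<close>; \<open>a2\<close> forces
    \<open>c1 > 0\<close> in the same way. Under \<open>a3\<close> two negative terms would then
    have to add up to 0.\<close>
  have "c2 > 0"
  proof (rule ccontr)
    assume "\<not> c2 > 0"
    then have "c2 * (a1 \<bullet> (y2 - x)) \<ge> 0"
      using a1(3) by (intro mult_nonpos_nonpos) auto
    with eq0[OF a1(1)] a1(2-) show False by simp
  qed
  moreover have "c1 > 0"
  proof (rule ccontr)
    assume "\<not> c1 > 0"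
    then have "c1 * (a2 \<bullet> (y1 - x)) \<ge> 0"
      using a2(3) by (intro mult_nonpos_nonpos) auto
    with eq0[OF a2(1)] a2(2-) show False by simp
  qed
  ultimately show False
    using eq0[OF a3(1)] a3(2-) mult_pos_neg[of c1 "a3 \<bullet> (y1 - x)"] mult_pos_neg[of c2 "a3 \<bullet> (y2 - x)"] by simp
qed

text \<open>At least two facets occur because a nonempty proper face is the intersection of the
  facets containing it, and a ridge has too small a dimension to be a facet itself.\<close>

lemma card_facets_through_ridge:
  fixes S :: "'a::euclidean_space set"
  assumes S: "polyhedron S" and R: "R face_of S" "R \<noteq> {}" "aff_dim R = aff_dim S - 2"
  shows "card {F. F facet_of S \<and> R \<subseteq> F} = 2"
proof -
  let ?\<F> = "{F. F facet_of S \<and> R \<subseteq> F}"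
  have RS: "R \<noteq> S" using R(3) by auto
  have R_eq: "R = \<Inter>?\<F>"
    using face_of_polyhedron[OF S R(1,2) RS] .
  obtain F where F: "F facet_of S" "R \<subseteq> F"
    using face_of_polyhedron_subset_facet[OF S R(1,2) RS] by blast
  have "R \<noteq> F" using F R(3) by (auto simp: facet_of_def)
  then obtain G where G: "G facet_of S" "R \<subseteq> G" "G \<noteq> F"
    using R_eq F by blast
  have "H \<in> {F, G}" if "H \<in> ?\<F>" for H
    using that facets_through_ridge_at_most_two[OF S R F(1) G(1) _ F(2) G(2) _ G(3)[symmetric], of H] by auto
  then have "?\<F> = {F, G}"
    using F G by blast
  then show ?thesis using G by simp
qed

section \<open>Geometric edges and their endpoint pairs\<close>

lemma finite_polytope_verts: "polytope P \<Longrightarrow> finite (polytope_verts P)"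
  by (simp add: polytope_verts_def finite_polyhedron_extreme_points polytope_imp_polyhedron)

lemma edge_of_polytope_segment:
  assumes "polytope P" "e edge_of P"
  obtains a b where "a \<noteq> b" "e = closed_segment a b" "polytope_verts e = {a, b}"
proof -
  have e: "e face_of P" "aff_dim e = 1" using assms(2) by (auto simp: edge_of_def)
  then have "polytope e" using assms(1) face_of_polytope_polytope by blast
  moreover have "e \<noteq> {}" using e(2) by auto
  ultimately obtain a b where ab: "e = closed_segment a b"
    using compact_convex_collinear_segment[of e] e(2)
    by (metis collinear_aff_dim order_refl polytope_imp_compact polytope_imp_convex)
  with e(2) have "a \<noteq> b" by auto
  moreover have "polytope_verts e = {a, b}"
    using ab by (auto simp: polytope_verts_def extreme_point_of_segment)
  ultimately show thesis using ab that by blast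
qed

text \<open>Links the graph edges, which are pairs of endpoints, to the one-dimensional faces, for
  which facet counting and \<open>num_edges\<close> are stated.\<close>

lemma polytope_edges_eq_image:
  assumes "polytope P"
  shows "polytope_edges P = polytope_verts ` {e. e edge_of P}"
proof (intro equalityI subsetI)
  fix d assume "d \<in> polytope_edges P"
  then obtain a b where "d = {a, b}" "closed_segment a b edge_of P"
    by (auto simp: polytope_edges_def)
  moreover have "polytope_verts (closed_segment a b) = {a, b}"
    by (auto simp: polytope_verts_def extreme_point_of_segment)
  ultimately show "d \<in> polytope_verts ` {e. e edge_of P}" by blast
next
  fix d assume "d \<in> polytope_verts ` {e. e edge_of P}"
  then obtain e where e: "e edge_of P" "d = polytope_verts e" by blast
  obtain a b where "a \<noteq> b" "e = closed_segment a b" "polytope_verts e = {a, b}"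
    by (rule edge_of_polytope_segment[OF assms e(1)])
  with e show "d \<in> polytope_edges P"
    unfolding polytope_edges_def by blast
qed

lemma convex_hull_polytope_verts: "polytope P \<Longrightarrow> convex hull (polytope_verts P) = P"
  unfolding polytope_verts_def
  by (rule Krein_Milman_Minkowski[symmetric]) (simp_all add: polytope_imp_compact polytope_imp_convex)

text \<open>A polytope is recovered from its vertices as their convex hull.\<close>

lemma inj_on_polytope_verts_edges:
  assumes "polytope P"
  shows "inj_on polytope_verts {e. e edge_of P}"
proof (rule inj_onI)
  fix e e' assume e: "e \<in> {e. e edge_of P}" "e' \<in> {e. e edge_of P}" "polytope_verts e = polytope_verts e'"
  have "polytope e" "polytope e'"
    using e assms face_of_polytope_polytope by (auto simp: edge_of_def)
  with e(3) show "e = e'" by (metis convex_hull_polytope_verts)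
qed

lemma finite_polytope_edges: "polytope P \<Longrightarrow> finite (polytope_edges P)"
  using finite_subset[OF _ finite_polytope_faces[of P], of "{e. e edge_of P}"]
  by (auto simp: polytope_edges_eq_image edge_of_def)

lemma num_edges_eq_card: "polytope P \<Longrightarrow> num_edges P = card (polytope_edges P)"
  by (simp add: num_edges_def polytope_edges_eq_image card_image inj_on_polytope_verts_edges)

lemma polytope_edgesE:
  assumes "polytope P" "d \<in> polytope_edges P"
  obtains a b where "a \<noteq> b" "d = {a, b}" "a \<in> polytope_verts P" "b \<in> polytope_verts P" "closed_segment a b edge_of P"
proof -
  obtain a b where ab: "d = {a, b}" "closed_segment a b edge_of P"
    using assms by (auto simp: polytope_edges_def)
  then have "a \<noteq> b" by (auto simp: edge_of_def)
  moreover have "a \<in> polytope_verts P" "b \<in> polytope_verts P"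
    using ab segment_face_of[of a b P] by (auto simp: edge_of_def polytope_verts_def)
  ultimately show thesis using ab that by blast
qed

lemma polytope_edges_face:
  assumes "C face_of P"
  shows "{a, b} \<in> polytope_edges C \<longleftrightarrow> {a, b} \<in> polytope_edges P \<and> closed_segment a b \<subseteq> C"
proof -
  have iff: "closed_segment a b edge_of C \<longleftrightarrow> closed_segment a b edge_of P \<and> closed_segment a b \<subseteq> C"
    using face_of_face[OF assms] by (auto simp: edge_of_def)
  have mem: "{a, b} \<in> polytope_edges Q \<longleftrightarrow> closed_segment a b edge_of Q" for Q
    by (auto simp: polytope_edges_def doubleton_eq_iff closed_segment_commute)
  show ?thesis using iff mem by simp
qed

lemma polytope_edges_face_subset: "C face_of P \<Longrightarrow> polytope_edges C \<subseteq> polytope_edges P"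
  by (auto simp: polytope_edges_def edge_of_def intro: face_of_trans)

text \<open>In a polygon the vertices are the ridges and the edges are the facets.\<close>

lemma card_polygon_edges_at_vertex:
  fixes C :: "'a::euclidean_space set"
  assumes C: "polytope C" "aff_dim C = 2" and x: "x \<in> polytope_verts C"
  shows "card {d \<in> polytope_edges C. x \<in> d} = 2"
proof -
  have "{x} face_of C" using x by (simp add: polytope_verts_def face_of_singleton)
  then have "card {F. F facet_of C \<and> {x} \<subseteq> F} = 2"
    using C by (intro card_facets_through_ridge polytope_imp_polyhedron) auto
  moreover have "{F. F facet_of C \<and> {x} \<subseteq> F} = {e. e edge_of C \<and> x \<in> e}"
    using C(2) by (auto simp: facet_of_def edge_of_def)
  moreover have "{d \<in> polytope_edges C. x \<in> d} = polytope_verts ` {e. e edge_of C \<and> x \<in> e}"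
  proof -
    have "x \<in> polytope_verts e \<longleftrightarrow> x \<in> e" if "e edge_of C" for e
      using that x extreme_point_of_face[of e C x] by (auto simp: edge_of_def polytope_verts_def)
    then show ?thesis unfolding polytope_edges_eq_image[OF C(1)] by auto
  qed
  moreover have "inj_on polytope_verts {e. e edge_of C \<and> x \<in> e}"
    using inj_on_polytope_verts_edges[OF C(1)] by (rule inj_on_subset) auto
  ultimately show ?thesis by (simp add: card_image)
qed

text \<open>In dimension 3 the edges are the ridges and the 2-faces are the facets.\<close>

lemma card_2_faces_at_edge:
  fixes P :: "'a::euclidean_space set"
  assumes P: "polytope P" "aff_dim P = 3" and d: "{v, u} \<in> polytope_edges P"
  shows "card {C \<in> incident_2_faces P v. {v, u} \<in> polytope_edges C} = 2"
proof -
  have seg: "closed_segment v u edge_of P"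
    using d by (auto simp: polytope_edges_def doubleton_eq_iff closed_segment_commute)
  then have "card {F. F facet_of P \<and> closed_segment v u \<subseteq> F} = 2"
    using P by (intro card_facets_through_ridge polytope_imp_polyhedron) (auto simp: edge_of_def)
  moreover have "{F. F facet_of P \<and> closed_segment v u \<subseteq> F} = {C \<in> incident_2_faces P v. {v, u} \<in> polytope_edges C}"
  proof (intro Collect_cong)
    fix C
    have "C face_of P \<Longrightarrow> {v, u} \<in> polytope_edges C \<longleftrightarrow> closed_segment v u \<subseteq> C"
      using d polytope_edges_face[of C P v u] by simp
    moreover have "closed_segment v u \<subseteq> C \<Longrightarrow> v \<in> C" by auto
    ultimately show "(C facet_of P \<and> closed_segment v u \<subseteq> C) = (C \<in> incident_2_faces P v \<and> {v, u} \<in> polytope_edges C)"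
      using P(2) by (auto simp: facet_of_def incident_2_faces_def)
  qed
  ultimately show ?thesis by simp
qed

text \<open>Two distinct 2-faces meet in a face of dimension at most 1, and an edge contained in
  such a face must be all of it.\<close>

lemma common_edge_unique:
  fixes P :: "'a::euclidean_space set"
  assumes C: "C face_of P" "aff_dim C = 2" "C' face_of P" "aff_dim C' = 2" "C \<noteq> C'"
    and d: "d \<in> polytope_edges C" "d \<in> polytope_edges C'" "d' \<in> polytope_edges C" "d' \<in> polytope_edges C'"
  shows "d = d'"
proof -
  let ?I = "C \<inter> C'"
  have I: "?I face_of P" using C face_of_Int by blast
  have cC: "convex C" "convex C'" using C face_of_imp_convex by blast+
  have "?I \<noteq> C"
  proof
    assume "?I = C"
    then have "C face_of C'" using C face_of_face by blast
    then have "aff_dim C < aff_dim C'" using C(5) by (rule face_of_aff_dim_lt[OF cC(2)])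
    with C show False by simp
  qed
  moreover have "?I face_of C" using I C face_of_face by blast
  ultimately have "aff_dim ?I < aff_dim C"
    using face_of_aff_dim_lt[OF cC(1)] by blast
  then have dim: "aff_dim ?I \<le> 1"
    using C(2) by simp
  have eq: "e = ?I" if e: "e edge_of P" "e \<subseteq> ?I" for e
  proof (rule ccontr)
    assume "e \<noteq> ?I"
    moreover have "e face_of ?I" using e face_of_face[OF I, of e] by (auto simp: edge_of_def)
    ultimately have "aff_dim e < aff_dim ?I"
      using face_of_aff_dim_lt face_of_imp_convex I by blast
    with dim e show False by (auto simp: edge_of_def)
  qed
  have "\<exists>e. e edge_of P \<and> e \<subseteq> ?I \<and> d = polytope_verts e"
    if d: "d \<in> polytope_edges C" "d \<in> polytope_edges C'" for d
  proof -
    obtain a b where "d = {a, b}" "closed_segment a b edge_of C"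
      using d by (auto simp: polytope_edges_def)
    moreover have "{a, b} \<in> polytope_edges C'" "{a, b} \<in> polytope_edges P" using calculation d C polytope_edges_face_subset by auto
    ultimately show ?thesis
      using polytope_edges_face[OF C(1)] polytope_edges_face[OF C(3)] d
      by (intro exI[of _ "closed_segment a b"])
         (auto simp: polytope_verts_def extreme_point_of_segment edge_of_def intro: face_of_trans C)
  qed
  with d eq show ?thesis by metis
qed

section \<open>Simple 3-polytopes\<close>

text \<open>\<open>R C u\<close> stands for the edge to the neighbour \<open>u\<close> lying on the
  face \<open>C\<close>. As \<open>card N = 3\<close>, each \<open>C\<close> misses exactly one
  neighbour \<open>g C\<close>. Two faces missing the same one would share the other two, so
  \<open>g\<close> is injective; double counting gives \<open>card \<C> = card N\<close>, hence it
  is onto.\<close>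

lemma opposite_bij:
  assumes N: "card N = 3" and fin: "finite \<C>"
    and two: "\<And>C. C \<in> \<C> \<Longrightarrow> card {u \<in> N. R C u} = 2" "\<And>u. u \<in> N \<Longrightarrow> card {C \<in> \<C>. R C u} = 2"
    and one: "\<And>C C' u u'. C \<in> \<C> \<Longrightarrow> C' \<in> \<C> \<Longrightarrow> C \<noteq> C' \<Longrightarrow> u \<in> N \<Longrightarrow> u' \<in> N \<Longrightarrow>
      R C u \<Longrightarrow> R C' u \<Longrightarrow> R C u' \<Longrightarrow> R C' u' \<Longrightarrow> u = u'"
  shows "\<exists>g. bij_betw g \<C> N \<and> (\<forall>C\<in>\<C>. \<forall>u\<in>N. R C u \<longleftrightarrow> u \<noteq> g C)"
proof -
  have finN: "finite N" using N by (metis card.infinite zero_neq_numeral)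
  have "\<exists>w\<in>N. \<forall>u\<in>N. R C u \<longleftrightarrow> u \<noteq> w" if "C \<in> \<C>" for C
  proof -
    have "card (N - {u \<in> N. R C u}) = 1"
      using two(1)[OF that] N finN by (subst card_Diff_subset) auto
    then obtain w where "N - {u \<in> N. R C u} = {w}" by (auto simp: card_1_singleton_iff)
    then show ?thesis by (intro bexI[of _ w]) blast+
  qed
  then obtain g where g: "\<And>C. C \<in> \<C> \<Longrightarrow> g C \<in> N" "\<And>C u. C \<in> \<C> \<Longrightarrow> u \<in> N \<Longrightarrow> R C u \<longleftrightarrow> u \<noteq> g C"
    by metis
  have "inj_on g \<C>"
  proof (rule inj_onI, rule ccontr)
    fix C C' assume C: "C \<in> \<C>" "C' \<in> \<C>" "g C = g C'" "C \<noteq> C'"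
    obtain u u' where "{u \<in> N. R C u} = {u, u'}" "u \<noteq> u'"
      using two(1)[OF C(1)] by (auto simp: card_2_iff)
    then have "u \<in> N" "u' \<in> N" "R C u" "R C u'" by auto
    with g C one[OF C(1,2,4)] \<open>u \<noteq> u'\<close> show False by metis
  qed
  moreover have "(\<Sum>C\<in>\<C>. card {u \<in> N. R C u}) = (\<Sum>u\<in>N. card {C \<in> \<C>. R C u})"
    using sum.swap_restrict[OF fin finN, of "\<lambda>_ _. 1::nat" R] by simp
  then have "card \<C> = card N"
    using two by simp
  ultimately have "g ` \<C> = N"
    using g(1) finN by (intro card_subset_eq) (auto simp: card_image)
  with \<open>inj_on g \<C>\<close> have "bij_betw g \<C> N" by (simp add: bij_betw_def)
  with g(2) show ?thesis by blast
qed

lemma two_regular_polygon_edges: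
  fixes C :: "'a::euclidean_space set"
  assumes C: "polytope C" "aff_dim C = 2"
  shows "two_regular (polytope_edges C)"
  unfolding two_regular_def
proof (intro conjI ballI)
  show "finite (polytope_edges C)" using C(1) by (rule finite_polytope_edges)
next
  fix e assume "e \<in> polytope_edges C"
  then show "card e = 2" by (rule polytope_edgesE[OF C(1)]) simp
next
  fix x assume "x \<in> \<Union> (polytope_edges C)"
  then have "x \<in> polytope_verts C" using polytope_edgesE[OF C(1)] by blast
  then show "card {e \<in> polytope_edges C. x \<in> e} = 2"
    by (rule card_polygon_edges_at_vertex[OF C])
qed

theorem theorem1p14:
  fixes P :: "'a::euclidean_space set" and v :: 'a
    and V :: "'a set" and E :: "'a set set" and \<C> :: "'a set set" and l :: "'a set \<Rightarrow> real"
  assumes "simple_3_polytope P"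
    and "V = polytope_verts P" and "E = polytope_edges P"
    and "v \<in> V"
    and "\<C> = incident_2_faces P v"
    and "\<And>C. C \<in> \<C> \<Longrightarrow> l C = real (num_edges C)"
  shows "resistance_curvature V E v \<ge>
    1 - 1/2 * (\<Sum>C\<in>\<C>. (l C - 1) / ((l C - 1) * ((\<Sum>C'\<in>\<C>. 1 / (l C' - 1)) + 1) - 1))"
proof -
  have P: "polytope P" "aff_dim P = 3" and reg: "regular_graph 3 V E"
    using assms(1-3) by (auto simp: simple_3_polytope_def)
  have fin: "finite V" "finite E" "finite \<C>"
    using P assms finite_polytope_verts finite_polytope_edges finite_subset[OF _ finite_polytope_faces[OF P(1)], of \<C>]
    by (auto simp: incident_2_faces_def)
  have E: "\<exists>a\<in>V. \<exists>b\<in>V. a \<noteq> b \<and> e = {a, b}" if "e \<in> E" for e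
    using that assms(2,3) polytope_edgesE[OF P(1)] by blast
  have C: "C face_of P" "aff_dim C = 2" "v \<in> C" "polytope C" if "C \<in> \<C>" for C
    using that assms(5) P(1) face_of_polytope_polytope by (auto simp: incident_2_faces_def)
  have CE: "polytope_edges C \<subseteq> E" if "C \<in> \<C>" for C
    using polytope_edges_face_subset[OF C(1)[OF that]] assms(3) by simp
  have reg2: "two_regular (polytope_edges C)" if "C \<in> \<C>" for C
    using two_regular_polygon_edges C[OF that] by blast
  let ?N = "nbrs V E v"
  have "\<exists>g. bij_betw g \<C> ?N \<and> (\<forall>C\<in>\<C>. \<forall>u\<in>?N. {u, v} \<in> polytope_edges C \<longleftrightarrow> u \<noteq> g C)"
  proof (rule opposite_bij)
    show "card ?N = 3" using reg assms(4) by (simp add: regular_graph_def)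
    show "card {u \<in> ?N. {u, v} \<in> polytope_edges C} = 2" if "C \<in> \<C>" for C
    proof -
      \<comment> \<open>Neighbours of \<open>v\<close> along \<open>C\<close> correspond to edges of
        the polygon \<open>C\<close> at \<open>v\<close>, of which there are two.\<close>
      have "{u \<in> ?N. {u, v} \<in> polytope_edges C} = nbrs V (polytope_edges C) v"
        using CE[OF that] by (auto simp: nbrs_def)
      also have "card \<dots> = card {d \<in> polytope_edges C. v \<in> d}"
        using sum_edges_at_vertex[of "polytope_edges C" V v "\<lambda>_. 1::nat"] E CE[OF that] assms(4) by auto
      also have "\<dots> = 2"
        using C[OF that] assms(2,4) extreme_point_of_face[of C P v]
        by (intro card_polygon_edges_at_vertex) (auto simp: polytope_verts_def)
      finally show ?thesis .
    qed
    show "card {C \<in> \<C>. {u, v} \<in> polytope_edges C} = 2" if "u \<in> ?N" for u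
      using card_2_faces_at_edge[OF P, of v u] that assms(3,5) by (simp add: nbrs_def insert_commute)
    show "u = u'" if "C \<in> \<C>" "C' \<in> \<C>" "C \<noteq> C'" "{u, v} \<in> polytope_edges C" "{u, v} \<in> polytope_edges C'"
      "{u', v} \<in> polytope_edges C" "{u', v} \<in> polytope_edges C'" for C C' u u'
      using common_edge_unique[OF C(1,2)[OF that(1)] C(1,2)[OF that(2)] that(3-7)]
      by (auto simp: doubleton_eq_iff)
    show "finite \<C>" by (fact fin(3))
  qed
  then obtain g where g: "bij_betw g \<C> ?N"
    "\<And>C u. C \<in> \<C> \<Longrightarrow> u \<in> ?N \<Longrightarrow> {u, v} \<in> polytope_edges C \<longleftrightarrow> u \<noteq> g C"
    by blast
  have l: "l C = real (card (polytope_edges C))" if "C \<in> \<C>" for C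
    using assms(6)[OF that] num_edges_eq_card C(4)[OF that] by simp
  \<comment> \<open>Makes \<open>l C - 1\<close> positive, so that the fractions can be cleared
    below.\<close>
  have l2: "l C \<ge> 2" if "C \<in> \<C>" for C
  proof -
    have "card {d \<in> polytope_edges C. v \<in> d} = 2"
      using C[OF that] assms(2,4) extreme_point_of_face[of C P v]
      by (intro card_polygon_edges_at_vertex) (auto simp: polytope_verts_def)
    moreover have "card {d \<in> polytope_edges C. v \<in> d} \<le> card (polytope_edges C)"
      using finite_polytope_edges[OF C(4)[OF that]] by (intro card_mono) auto
    ultimately show ?thesis using l[OF that] by simp
  qed
  let ?S = "\<Sum>C'\<in>\<C>. 1 / (l C' - 1)"
  have bound: "effective_resistance V E (g C) v \<le> (l C - 1) / ((l C - 1) * (?S + 1) - 1)" if CC: "C \<in> \<C>" for C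
  proof -
    have gN: "g C \<in> ?N" using g(1) CC by (auto simp: bij_betw_def)
    have inc: "{g C, v} \<in> polytope_edges C'" if "C' \<in> \<C> - {C}" for C'
    \<comment> \<open>By injectivity of \<open>g\<close>, a face other than \<open>C\<close> does
      not miss \<open>g C\<close>.\<close>
    proof -
      have "g C \<noteq> g C'" using g(1) that CC by (auto simp: bij_betw_def inj_on_def)
      then show ?thesis using g(2)[of C' "g C"] gN that by simp
    qed
    \<comment> \<open>The parallel cycles are the boundaries of the faces at \<open>v\<close> other
      than \<open>C\<close>, all of which contain the edge from \<open>v\<close> to
      \<open>g C\<close>.\<close>
    have "effective_resistance V E (g C) v \<le> 1 / (1 + (\<Sum>C'\<in>\<C> - {C}. 1 / (real (card (polytope_edges C')) - 1)))"
    proof (rule effective_resistance_le_parallel_cycles[OF fin(1,2) E])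
      fix C1 C2 assume "C1 \<in> \<C> - {C}" "C2 \<in> \<C> - {C}" "C1 \<noteq> C2"
      then show "polytope_edges C1 \<inter> polytope_edges C2 = {{g C, v}}"
        using common_edge_unique[OF C(1,2)[of C1] C(1,2)[of C2]] inc by blast
    next
      show "finite (\<C> - {C})" using fin(3) by simp
      show "{g C, v} \<in> E" using gN by (simp add: nbrs_def)
      fix C' assume C': "C' \<in> \<C> - {C}"
      then show "two_regular (polytope_edges C')" "polytope_edges C' \<subseteq> E"
        using reg2 CE by simp_all
      show "{g C, v} \<in> polytope_edges C'" using C' by (rule inc)
    qed
    also have "(\<Sum>C'\<in>\<C> - {C}. 1 / (real (card (polytope_edges C')) - 1)) = ?S - 1 / (l C - 1)"
      using sum.remove[OF fin(3) CC, of "\<lambda>C'. 1 / (l C' - 1)"] l by simp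
    \<comment> \<open>Numerator and denominator are multiplied by \<open>l C - 1\<close>, which
      yields the summand of the theorem.\<close>
    also have "1 / (1 + (?S - 1 / (l C - 1))) = (l C - 1) / ((l C - 1) * (?S + 1) - 1)"
    proof -
      have "(l C - 1) * (1 + (?S - 1 / (l C - 1))) = (l C - 1) * (?S + 1) - 1"
        using l2[OF CC] by (simp add: algebra_simps)
      moreover have "1 / x = (l C - 1) / ((l C - 1) * x)" for x
        using l2[OF CC] by simp
      ultimately show ?thesis by metis
    qed
    finally show ?thesis .
  qed
  have "(\<Sum>u\<in>?N. effective_resistance V E u v) = (\<Sum>C\<in>\<C>. effective_resistance V E (g C) v)"
    by (rule sum.reindex_bij_betw[OF g(1), symmetric])
  also have "\<dots> \<le> (\<Sum>C\<in>\<C>. (l C - 1) / ((l C - 1) * (?S + 1) - 1))"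
    using bound by (rule sum_mono)
  finally show ?thesis
    by (simp add: resistance_curvature_def)
qed

end
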